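(* For all $(t,j)\in A$, the inequality $x_{1,j,t}\le y_{t,t,j}$ is facet-defining for $P_{\mathrm{utt}}(n)$.
   Context: Let $n\ge4$ be even, $V=\{1,\dots,n\}$ (teams; team $i$ has home venue $i$), $S=\{1,\dots,2n-2\}$ (slots), $A=\{(i,j)\in V\times V:i\ne j\}$, $\mathcal M=\{(k,i,j):k\in S,(i,j)\in A\}$, where $(k,i,j)$ denotes the match between $i$ and $j$ at venue $i$ in slot $k$. Coordinates are $x_{k,i,j}$ ($(k,i,j)\in\mathcal M$) and $y_{t,i,j}$ ($t\in V$, $(i,j)\in A$). A tournament is a set $T\subseteq\mathcal M$ whose incidence vector $x=\chi(T)\in\{0,1\}^{\mathcal M}$ satisfies $\sum_{j\in V\setminus\{i\}}(x_{k,i,j}+x_{k,j,i})=1$ for all $k\in S$, $k\ge2$, $i\in V$, and $\sum_{k\in S}x_{k,i,j}=1$ for all $(i,j)\in A$. In $T$, team $t$ is at venue $t$ in a slot where it plays at home and at venue $i$ in slot $k$ if $(k,i,t)\in T$; before slot 1 and after slot $2n-2$ it is at venue $t$. Team $t$ travels from venue $i$ to venue $j\ne i$ if it is at $i$ and then at $j$ at consecutive positions of (start, slot $1$, …, slot $2n-2$, end). The travel vector $\psi(T)\in\{0,1\}^{V\times A}$ has $\psi(T)_{t,i,j}=1$ iff team $t$ travels from $i$ to $j$. $P_{\mathrm{utt}}(n)=\mathrm{conv}\{(\chi(T),y)\in\{0,1\}^{\mathcal M}\times\{0,1\}^{V\times A}: T\text{ tournament},\ y\ge\psi(T)\}$.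 An inequality is facet-defining if it is valid and the face it induces is a facet. *)

theory Defs
  imports "HOL-Analysis.Analysis"
begin

definition teams :: "nat \<Rightarrow> nat set" where
  "teams n = {1..n}"

definition slots :: "nat \<Rightarrow> nat set" where
  "slots n = {1..2 * n - 2}"

definition arcs :: "nat \<Rightarrow> (nat \<times> nat) set" where
  "arcs n = {(i, j). i \<in> teams n \<and> j \<in> teams n \<and> i \<noteq> j}"

text \<open>The triple \<open>(k, i, j)\<close> is the match in slot \<open>k\<close> between \<open>i\<close> and \<open>j\<close> at venue \<open>i\<close>.\<close>

definition matches :: "nat \<Rightarrow> (nat \<times> nat \<times> nat) set" where
  "matches n = slots n \<times> arcs n"

text \<open>Slot 1 is deliberately absent from the first family of equations: the equations for it
  follow from the others.\<close>

definition tournament :: "nat \<Rightarrow> (nat \<times> nat \<times> nat) set \<Rightarrow> bool" where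
  "tournament n T \<longleftrightarrow> T \<subseteq> matches n \<and>
     (\<forall>k\<in>slots n. k \<ge> 2 \<longrightarrow> (\<forall>i\<in>teams n.
        (\<Sum>j\<in>teams n - {i}. indicator T (k, i, j) + indicator T (k, j, i)) = (1::nat))) \<and>
     (\<forall>(i, j)\<in>arcs n. (\<Sum>k\<in>slots n. indicator T (k, i, j)) = (1::nat))"

text \<open>Positions \<open>0\<close> and \<open>2 * n - 1\<close> are the start and the end of the season; position
  \<open>k\<close> with \<open>1 \<le> k \<le> 2 * n - 2\<close> is slot \<open>k\<close>.\<close>

definition at_venue :: "nat \<Rightarrow> (nat \<times> nat \<times> nat) set \<Rightarrow> nat \<Rightarrow> nat \<Rightarrow> nat \<Rightarrow> bool" where
  "at_venue n T t p i \<longleftrightarrow>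
     (p \<in> {0, 2 * n - 1} \<and> i = t) \<or>
     (p \<in> slots n \<and> i = t \<and> (\<exists>j. (p, t, j) \<in> T)) \<or>
     (p \<in> slots n \<and> (p, i, t) \<in> T)"

definition travels :: "nat \<Rightarrow> (nat \<times> nat \<times> nat) set \<Rightarrow> nat \<Rightarrow> nat \<Rightarrow> nat \<Rightarrow> bool" where
  "travels n T t i j \<longleftrightarrow>
     i \<noteq> j \<and> (\<exists>p. p < 2 * n - 1 \<and> at_venue n T t p i \<and> at_venue n T t (p + 1) j)"

text \<open>The number \<open>n\<close> of teams enters the ambient space as the cardinality of a type \<open>'n\<close>.
  The two index types have exactly the elements of \<open>matches n\<close> and of
  \<open>teams n \<times> arcs n\<close>; class \<^class>\<open>card2\<close> (at least two elements) makes these sets nonempty.\<close>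

lemma one_two_in_arcs: "(1, 2) \<in> arcs CARD('n::card2)"
  using one_less_card[where 'a = 'n] by (simp add: arcs_def teams_def)

typedef ('n::card2) match_index = "matches CARD('n)"
  morphisms match_triple match_index
proof
  show "(1, 1, 2) \<in> matches CARD('n)"
    using one_two_in_arcs[where 'n = 'n] one_less_card[where 'a = 'n]
    by (simp add: matches_def slots_def)
qed

typedef ('n::card2) travel_index = "teams CARD('n) \<times> arcs CARD('n)"
  morphisms travel_triple travel_index
proof
  show "(1, 1, 2) \<in> teams CARD('n) \<times> arcs CARD('n)"
    using one_two_in_arcs[where 'n = 'n] one_less_card[where 'a = 'n]
    by (simp add: teams_def)
qed

lemma finite_arcs: "finite (arcs n)"
  by (rule finite_subset[of _ "teams n \<times> teams n"]) (auto simp: arcs_def teams_def)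

instance match_index :: (card2) finite
proof
  have "finite (matches CARD('a))"
    by (simp add: matches_def slots_def finite_arcs)
  then show "finite (UNIV :: 'a match_index set)"
    using type_definition.univ[OF type_definition_match_index[where 'n = 'a]]
    by (metis finite_imageI)
qed

instance travel_index :: (card2) finite
proof
  have "finite (teams CARD('a) \<times> arcs CARD('a))"
    by (simp add: teams_def finite_arcs)
  then show "finite (UNIV :: 'a travel_index set)"
    using type_definition.univ[OF type_definition_travel_index[where 'n = 'a]]
    by (metis finite_imageI)
qed

type_synonym 'n utt_space = "(real ^ 'n match_index) \<times> (real ^ 'n travel_index)"

definition chi :: "(nat \<times> nat \<times> nat) set \<Rightarrow> real ^ ('n::card2) match_index" where
  "chi T = (\<chi> m. indicator T (match_triple m))"

definition psi :: "(nat \<times> nat \<times> nat) set \<Rightarrow> real ^ ('n::card2) travel_index" where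
  "psi T = (\<chi> a. case travel_triple a of (t, i, j) \<Rightarrow> of_bool (travels CARD('n) T t i j))"

definition p_utt :: "('n::card2) utt_space set" where
  "p_utt = convex hull
     {(chi T, y) | T y. tournament CARD('n) T \<and> (\<forall>a. y $ a \<in> {0, 1}) \<and> (\<forall>a. psi T $ a \<le> y $ a)}"

text \<open>The inequality \<open>l z \<le> r z\<close>, with affine \<open>l\<close> and \<open>r\<close>, is valid and induces a facet.\<close>

definition facet_defining ::
    "'a::euclidean_space set \<Rightarrow> ('a \<Rightarrow> real) \<Rightarrow> ('a \<Rightarrow> real) \<Rightarrow> bool" where
  "facet_defining P l r \<longleftrightarrow> (\<forall>z\<in>P. l z \<le> r z) \<and> {z \<in> P. l z = r z} facet_of P"

end

theory Submission
  imports Defs "HOL-Number_Theory.Cong"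
begin

text \<open>Consider the affine hull of the face together with one vertex off it; it contains the whole
  polytope for two reasons. First, each travel coordinate other than \<open>(t, t, j)\<close> can be toggled within
  the face, because some tournament with match \<open>(1, j, t)\<close> avoids the corresponding travel, and the
  extra vertex is chosen to toggle \<open>(t, t, j)\<close>. It remains to reach every \<open>chi T\<close>.
  Second, for permutations \<open>\<sigma>\<close>, \<open>\<tau>\<close> of the slots with disjoint supports,
  \<open>chi T = chi (\<sigma> T) + chi (\<tau> T) - chi (\<sigma> (\<tau> T))\<close>. If \<open>T\<close> does not extend to a point of the face,
  then at most two uses of this identity with transpositions \<open>\<sigma>\<close>, \<open>\<tau>\<close> express \<open>chi T\<close> by tournaments
  in which \<open>t\<close> visits \<open>j\<close> either in slot 1 or directly after another away match; in the latter case
  \<open>t\<close> does not travel from \<open>t\<close> to \<open>j\<close>.\<close>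

section \<open>Tournaments as slot assignments\<close>

text \<open>Tournaments are handled as functions from the ordered pairs of teams to slots.\<close>

definition incident :: "nat \<Rightarrow> nat \<Rightarrow> (nat \<times> nat) set" where
  "incident n i = {a \<in> arcs n. fst a = i \<or> snd a = i}"

text \<open>Each team has \<open>2 * n - 2\<close> incident matches, as many as there are slots, so
  injectivity on \<open>incident n i\<close> makes it play exactly once in every slot, slot 1
  included.\<close>

definition schedule :: "nat \<Rightarrow> (nat \<times> nat \<Rightarrow> nat) \<Rightarrow> bool" where
  "schedule n s \<longleftrightarrow> s ` arcs n \<subseteq> slots n \<and> (\<forall>i\<in>teams n. inj_on s (incident n i))"

definition fixtures :: "nat \<Rightarrow> (nat \<times> nat \<Rightarrow> nat) \<Rightarrow> (nat \<times> nat \<times> nat) set" where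
  "fixtures n s = (\<lambda>a. (s a, a)) ` arcs n"

lemma mem_fixtures [simp]: "(k, a) \<in> fixtures n s \<longleftrightarrow> a \<in> arcs n \<and> s a = k"
  by (auto simp: fixtures_def)

lemma mem_arcs: "(i, j) \<in> arcs n \<longleftrightarrow> i \<in> teams n \<and> j \<in> teams n \<and> i \<noteq> j"
  by (simp add: arcs_def)

lemma schedule_slots: "schedule n s \<Longrightarrow> a \<in> arcs n \<Longrightarrow> s a \<in> slots n"
  by (auto simp: schedule_def)

lemma schedule_inj:
  assumes "schedule n s" "a \<in> arcs n" "b \<in> arcs n" "s a = s b"
    and "fst a = i \<or> snd a = i" "fst b = i \<or> snd b = i"
  shows "a = b"
proof -
  have "i \<in> teams n"
    using assms(2,5) by (auto simp: arcs_def)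
  then have "inj_on s (incident n i)"
    using assms(1) by (simp add: schedule_def)
  then show ?thesis
    using assms(2-6) by (auto simp: incident_def dest: inj_onD)
qed

lemma incident_eq:
  assumes "i \<in> teams n"
  shows "incident n i = Pair i ` (teams n - {i}) \<union> (\<lambda>j. (j, i)) ` (teams n - {i})"
  using assms by (auto simp: incident_def arcs_def)

lemma sum_incident:
  fixes f :: "nat \<times> nat \<Rightarrow> nat"
  assumes "i \<in> teams n"
  shows "(\<Sum>a\<in>incident n i. f a) = (\<Sum>j\<in>teams n - {i}. f (i, j) + f (j, i))"
proof -
  have fin: "finite (teams n)"
    by (simp add: teams_def)
  have "(\<Sum>a\<in>incident n i. f a) =
      sum f (Pair i ` (teams n - {i})) + sum f ((\<lambda>j. (j, i)) ` (teams n - {i}))"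
    unfolding incident_eq[OF assms] by (rule sum.union_disjoint) (auto simp: fin)
  also have "sum f (Pair i ` (teams n - {i})) = (\<Sum>j\<in>teams n - {i}. f (i, j))"
    by (subst sum.reindex) (auto simp: inj_on_def)
  also have "sum f ((\<lambda>j. (j, i)) ` (teams n - {i})) = (\<Sum>j\<in>teams n - {i}. f (j, i))"
    by (subst sum.reindex) (auto simp: inj_on_def)
  finally show ?thesis
    by (simp add: sum.distrib)
qed

lemma finite_incident: "finite (incident n i)"
  unfolding incident_def using finite_arcs by simp

lemma card_incident:
  assumes "i \<in> teams n"
  shows "card (incident n i) = 2 * n - 2"
  using sum_incident[OF assms, of "\<lambda>_. 1"] assms by (simp add: teams_def)

lemma card_slots: "card (slots n) = 2 * n - 2"
  by (simp add: slots_def)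

lemma finite_slots: "finite (slots n)"
  by (simp add: slots_def)

lemma tournament_fixtures:
  assumes "schedule n s"
  shows "tournament n (fixtures n s)"
  unfolding tournament_def
proof (intro conjI ballI impI)
  show "fixtures n s \<subseteq> matches n"
    using assms by (auto simp: fixtures_def matches_def schedule_def)
next
  fix k i
  assume k: "k \<in> slots n" and i: "i \<in> teams n"
  have inj: "inj_on s (incident n i)"
    using assms i by (simp add: schedule_def)
  have sub: "s ` incident n i \<subseteq> slots n"
    using assms by (auto simp: schedule_def incident_def)
  have surj: "s ` incident n i = slots n"
    by (rule card_subset_eq) (simp_all add: sub finite_slots card_slots card_image[OF inj] card_incident[OF i])
  have "(\<Sum>j\<in>teams n - {i}. indicator (fixtures n s) (k, i, j) + indicator (fixtures n s) (k, j, i))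
      = (\<Sum>a\<in>incident n i. indicator (fixtures n s) (k, a) :: nat)"
    by (simp add: sum_incident[OF i])
  also have "\<dots> = (\<Sum>a\<in>incident n i. of_bool (s a = k))"
    by (rule sum.cong) (auto simp: incident_def indicator_def)
  also have "\<dots> = (\<Sum>x\<in>slots n. of_bool (x = k))"
    unfolding surj[symmetric] by (simp add: sum.reindex[OF inj])
  also have "\<dots> = 1"
    using k finite_slots by simp
  finally show "(\<Sum>j\<in>teams n - {i}. indicator (fixtures n s) (k, i, j) +
      indicator (fixtures n s) (k, j, i)) = (1::nat)" .
next
  fix a assume a: "a \<in> arcs n"
  have "(\<Sum>k\<in>slots n. indicator (fixtures n s) (k, a)) = (\<Sum>k\<in>slots n. of_bool (k = s a) :: nat)"
    using a by (intro sum.cong) (auto simp: indicator_def)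
  also have "\<dots> = 1"
    using schedule_slots[OF assms a] finite_slots by simp
  finally show "case a of (i, j) \<Rightarrow> (\<Sum>k\<in>slots n. indicator (fixtures n s) (k, i, j)) = (1::nat)"
    by (simp add: case_prod_unfold)
qed

lemma sum_indicator_eq_1D:
  assumes "(\<Sum>x\<in>A. indicator T (f x)) = (1::nat)" and "finite A"
  shows "\<exists>!x. x \<in> A \<and> f x \<in> T"
proof -
  have "card {x \<in> A. f x \<in> T} = 1"
    using assms by (simp add: indicator_def if_distrib sum.If_cases Int_def)
  then obtain x where "{x \<in> A. f x \<in> T} = {x}"
    by (rule card_1_singletonE)
  then show ?thesis
    by (intro ex1I[of _ x]) (auto simp: set_eq_iff)
qed

text \<open>Injectivity at slot 1, where no equation is available, follows by counting: two matches of
  team \<open>i\<close> in slot 1 would leave too few for the remaining slots.\<close>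

lemma tournament_imp_schedule:
  assumes T: "tournament n T"
  obtains s where "schedule n s" and "T = fixtures n s"
proof -
  have sub: "T \<subseteq> matches n"
    using T by (simp add: tournament_def)
  \<comment> \<open>Outside \<open>arcs n\<close> the value is arbitrary; \<open>schedule\<close>
    and \<open>fixtures\<close> look only at arcs.\<close>
  define s where "s a = (THE k. k \<in> slots n \<and> (k, a) \<in> T)" for a
  have ex1: "\<exists>!k. k \<in> slots n \<and> (k, a) \<in> T" if "a \<in> arcs n" for a
  proof (rule sum_indicator_eq_1D)
    show "(\<Sum>k\<in>slots n. indicator T (k, a)) = (1::nat)"
      using T that by (cases a) (auto simp: tournament_def)
  qed (rule finite_slots)
  have s: "s a \<in> slots n" "(s a, a) \<in> T" if "a \<in> arcs n" for a
    using theI'[OF ex1[OF that]] by (auto simp: s_def)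
  have s_eq: "k = s a" if "(k, a) \<in> T" for k a
    using that sub ex1[of a] s[of a] by (auto simp: matches_def)
  have inj: "inj_on s (incident n i)" if i: "i \<in> teams n" for i
  proof (rule inj_onI, rule ccontr)
    fix a b
    assume ab: "a \<in> incident n i" "b \<in> incident n i" "s a = s b" "a \<noteq> b"
    have ex: "\<exists>!x. x \<in> incident n i \<and> (k, x) \<in> T" if "k \<in> slots n" "k \<ge> 2" for k
    proof (rule sum_indicator_eq_1D[OF _ finite_incident])
      show "(\<Sum>x\<in>incident n i. indicator T (k, x)) = (1::nat)"
        using T that i by (simp add: sum_incident[OF i] tournament_def)
    qed
    have inc: "x \<in> arcs n" if "x \<in> incident n i" for x
      using that by (simp add: incident_def)
    \<comment> \<open>A repeated slot from 2 on would violate its equation, so only a clash in slot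
      1 is left to exclude.\<close>
    have not_ge2: "\<not> s a \<ge> 2"
      using ex[of "s a"] s[OF inc[OF ab(1)]] s[OF inc[OF ab(2)]] ab by auto
    have "{2..2 * n - 2} \<subseteq> s ` (incident n i - {a, b})"
    proof
      fix k assume k: "k \<in> {2..2 * n - 2}"
      then obtain x where x: "x \<in> incident n i" "(k, x) \<in> T"
        using ex[of k] by (auto simp: slots_def)
      then have "k = s x"
        using s_eq by blast
      moreover have "x \<noteq> a" "x \<noteq> b"
        using not_ge2 ab k calculation by auto
      ultimately show "k \<in> s ` (incident n i - {a, b})"
        using x by blast
    qed
    then have "card {2..2 * n - 2} \<le> card (incident n i - {a, b})"
      by (rule surj_card_le[rotated]) (simp add: finite_incident)
    moreover have "card (incident n i - {a, b}) = 2 * n - 2 - 2"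
      using ab by (subst card_Diff_subset) (auto simp: card_incident[OF i])
    \<comment> \<open>This yields \<open>2 \<le> 2 * n - 2\<close>, so the truncated subtraction
      above is a true one, and \<open>2 * n - 4\<close> matches cannot cover
      \<open>2 * n - 3\<close> slots.\<close>
    moreover have "card {a, b} \<le> card (incident n i)"
      using ab by (intro card_mono) (auto simp: finite_incident)
    ultimately show False
      using ab card_incident[OF i] by auto
  qed
  show thesis
  proof
    show "schedule n s"
      using s inj by (auto simp: schedule_def)
    show "T = fixtures n s"
      using s s_eq sub by (auto simp: matches_def)
  qed
qed

section \<open>Renaming slots and reversing venues\<close>

lemma schedule_permute:
  assumes "schedule n s" and "\<pi> permutes slots n"
  shows "schedule n (\<pi> \<circ> s)"
  using assms permutes_inj[OF assms(2)]
  by (auto simp: schedule_def permutes_in_image intro!: comp_inj_on elim: inj_on_subset)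

text \<open>The matches \<open>(i, j)\<close> and \<open>(j, i)\<close> involve the same two teams,
  so exchanging their slots creates no clash for any team.\<close>

lemma schedule_reverse_pair:
  assumes s: "schedule n s" and ij: "(i, j) \<in> arcs n"
  shows "schedule n (s \<circ> Transposition.transpose (i, j) (j, i))"
proof -
  let ?\<tau> = "Transposition.transpose (i, j) (j, i)"
  have inc: "?\<tau> a \<in> incident n k" if "a \<in> incident n k" for a k
    using that ij by (auto simp: incident_def arcs_def Transposition.transpose_def)
  have "?\<tau> a \<in> arcs n" if "a \<in> arcs n" for a
    using that ij by (auto simp: arcs_def Transposition.transpose_def)
  moreover have "inj_on (s \<circ> ?\<tau>) (incident n k)" if "k \<in> teams n" for k
  proof (rule comp_inj_on)
    show "inj_on s (?\<tau> ` incident n k)"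
      using s that inc by (auto simp: schedule_def intro: inj_on_subset)
  qed (rule inj_on_subset[OF Transposition.inj_transpose], simp)
  ultimately show ?thesis
    using s by (auto simp: schedule_def)
qed

text \<open>Three transpositions place the images one after another; each fixes the images already
  placed.\<close>

lemma permutes_three:
  assumes "u \<in> S" "v \<in> S" "w \<in> S" "u \<noteq> v" "u \<noteq> w" "v \<noteq> w"
    and "x \<in> S" "y \<in> S" "z \<in> S" "x \<noteq> y" "x \<noteq> z" "y \<noteq> z"
  obtains \<pi> where "\<pi> permutes S" "\<pi> u = x" "\<pi> v = y" "\<pi> w = z"
proof -
  define p where "p = Transposition.transpose u x"
  define q where "q = Transposition.transpose (p v) y \<circ> p"
  define r where "r = Transposition.transpose (q w) z \<circ> q"
  have p: "p permutes S" "p u = x"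
    unfolding p_def using assms by (auto intro: permutes_swap_id)
  have pv: "p v \<noteq> x" "p v \<in> S"
    using p assms by (auto dest: permutes_inj injD simp: permutes_in_image)
  have q: "q permutes S" "q u = x" "q v = y"
    unfolding q_def using p pv assms
    by (auto intro!: permutes_compose permutes_swap_id simp: Transposition.transpose_def)
  have qw: "q w \<noteq> x" "q w \<noteq> y" "q w \<in> S"
    using q assms by (auto dest: permutes_inj injD simp: permutes_in_image)
  have "r permutes S" "r u = x" "r v = y" "r w = z"
    unfolding r_def using q qw assms
    by (auto intro!: permutes_compose permutes_swap_id simp: Transposition.transpose_def)
  then show thesis
    by (rule that)
qed

text \<open>Slots are interchangeable, so to play matches in slots 1, 2, 3 in a chosen order it
  suffices that their slots are distinct.\<close>

lemma schedule_first_three: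
  assumes s: "schedule n s" and n: "n \<ge> 4"
    and "u \<in> slots n" "v \<in> slots n" "w \<in> slots n" "u \<noteq> v" "u \<noteq> w" "v \<noteq> w"
  obtains s' where "schedule n s'" "\<And>a. s a = u \<Longrightarrow> s' a = 1"
    "\<And>a. s a = v \<Longrightarrow> s' a = 2" "\<And>a. s a = w \<Longrightarrow> s' a = 3"
proof -
  have "1 \<in> slots n" "2 \<in> slots n" "3 \<in> slots n"
    using n by (auto simp: slots_def)
  with assms obtain \<pi> where "\<pi> permutes slots n" "\<pi> u = 1" "\<pi> v = 2" "\<pi> w = 3"
    using permutes_three[of u "slots n" v w 1 2 3] by auto
  with that[of "\<pi> \<circ> s"] schedule_permute[OF s] show thesis
    by auto
qed

section \<open>Existence of a schedule\<close>

text \<open>The circle method: modulo the odd number \<open>n - 1\<close>, teams \<open>i\<close> and \<open>j\<close> below \<open>n\<close> meet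
  in round \<open>i + j\<close>, and team \<open>n\<close> fills the gap left by \<open>i = j\<close>. The second half of the season
  repeats the rounds with reversed venues.\<close>

definition round_of :: "nat \<Rightarrow> nat \<Rightarrow> nat \<Rightarrow> nat" where
  "round_of n i j = (if j = n then 2 * i else if i = n then 2 * j else i + j) mod (n - 1)"

lemma round_of_commute: "round_of n i j = round_of n j i"
  by (auto simp: round_of_def add.commute)

lemma round_of_inj:
  assumes n: "even n" "n \<ge> 2" and ij: "(i, j) \<in> arcs n" and ik: "(i, k) \<in> arcs n"
    and eq: "round_of n i j = round_of n i k"
  shows "j = k"
proof -
  have small: "x = y" if "[x = y] (mod (n - 1))" "x \<in> {1..n - 1}" "y \<in> {1..n - 1}" for x y :: nat
  proof -
    have "[x - 1 = y - 1] (mod (n - 1))"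
      using that by (metis One_nat_def Suc_pred' atLeastAtMost_iff cong_add_rcancel_nat
          le_add_diff_inverse2 less_eq_Suc_le)
    then show ?thesis
      using that cong_less_modulus_unique_nat[of "x - 1" "y - 1" "n - 1"] by simp linarith
  qed
  show ?thesis
  proof (cases "i = n")
    case True
    then have "[2 * j = 2 * k] (mod (n - 1))"
      using eq ij ik by (simp add: round_of_def cong_def arcs_def)
    moreover have "coprime 2 (n - 1)"
      using n by simp
    ultimately have "[j = k] (mod (n - 1))"
      by (simp add: cong_mult_lcancel_nat)
    then show ?thesis
      using small[of j k] True ij ik by (auto simp: arcs_def teams_def)
  next
    case False
    \<comment> \<open>Since \<open>2 * i = i + i\<close>, meeting team \<open>n\<close> counts as
      meeting \<open>i\<close> itself; the opponents then become distinct residues from 1 to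
      \<open>n - 1\<close>.\<close>
    let ?f = "\<lambda>x. if x = n then i else x"
    have "[i + ?f j = i + ?f k] (mod (n - 1))"
      using eq False by (simp add: round_of_def cong_def mult_2 split: if_splits)
    then have "[?f j = ?f k] (mod (n - 1))"
      by (simp only: cong_add_lcancel_nat)
    then have "?f j = ?f k"
      using False ij ik by (intro small) (auto simp: arcs_def teams_def)
    then show ?thesis
      using ij ik by (auto simp: arcs_def split: if_splits)
  qed
qed

lemma ex_schedule:
  assumes n: "even n" "n \<ge> 2"
  obtains s where "schedule n s"
proof -
  define s where "s = (\<lambda>(i, j). 1 + round_of n i j + (if i < j then 0 else n - 1))"
  have r: "round_of n i j < n - 1" for i j
    using n by (simp add: round_of_def)
  \<comment> \<open>The two halves occupy slots 1 to \<open>n - 1\<close> and \<open>n\<close> to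
    \<open>2 * n - 2\<close>, so a slot determines both the half and the round.\<close>
  have key: "(i < j) = (k < l) \<and> round_of n i j = round_of n k l" if "s (i, j) = s (k, l)" for i j k l
    using that r[of i j] r[of k l] by (auto simp: s_def split: if_splits)
  have "inj_on s (incident n i)" for i
  proof (rule inj_onI)
    fix a b assume ab: "a \<in> incident n i" "b \<in> incident n i" "s a = s b"
    obtain a1 a2 b1 b2 where [simp]: "a = (a1, a2)" "b = (b1, b2)"
      by (cases a, cases b)
    have k: "(a1 < a2) = (b1 < b2)" "round_of n a1 a2 = round_of n b1 b2"
      using key[of a1 a2 b1 b2] ab(3) by auto
    have arcs: "(a1, a2) \<in> arcs n" "(b1, b2) \<in> arcs n" "(a2, a1) \<in> arcs n" "(b2, b1) \<in> arcs n"
      using ab by (auto simp: incident_def arcs_def)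
    consider "a1 = i" "b1 = i" | "a1 = i" "b2 = i" | "a2 = i" "b1 = i" | "a2 = i" "b2 = i"
      using ab by (auto simp: incident_def)
    then show "a = b"
    proof cases
      case 1
      then show ?thesis
        using k arcs round_of_inj[OF n, of i a2 b2] by simp
    next
      \<comment> \<open>The same pair in opposite directions is impossible, as the two directions
        lie in different halves.\<close>
      case 2
      then have "a2 = b1"
        using k arcs round_of_inj[OF n, of i a2 b1] round_of_commute[of n] by simp
      then show ?thesis
        using 2 k arcs by (auto simp: mem_arcs)
    next
      case 3
      then have "a1 = b2"
        using k arcs round_of_inj[OF n, of i a1 b2] round_of_commute[of n] by simp
      then show ?thesis
        using 3 k arcs by (auto simp: mem_arcs)
    next
      case 4
      then show ?thesis
        using k arcs round_of_inj[OF n, of i a1 b1] round_of_commute[of n] by simp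
    qed
  qed
  moreover have "s a \<in> slots n" if "a \<in> arcs n" for a
    using r[of "fst a" "snd a"] by (auto simp: s_def slots_def case_prod_unfold)
  ultimately have "schedule n s"
    by (auto simp: schedule_def)
  then show thesis
    by (rule that)
qed

section \<open>Travels and how to avoid them\<close>

lemma at_venue_fixtures:
  assumes "schedule n s"
  shows "at_venue n (fixtures n s) t p i \<longleftrightarrow>
     (p \<in> {0, 2 * n - 1} \<and> i = t) \<or> (i = t \<and> (\<exists>x. (t, x) \<in> arcs n \<and> s (t, x) = p)) \<or>
     ((i, t) \<in> arcs n \<and> s (i, t) = p)"
  using schedule_slots[OF assms] by (auto simp: at_venue_def)

lemma travels_away_away:
  assumes "schedule n s" "travels n (fixtures n s) t i j" "i \<noteq> t" "j \<noteq> t"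
  shows "s (j, t) = s (i, t) + 1"
  using assms(2-4) unfolding travels_def at_venue_fixtures[OF assms(1)] by auto

text \<open>Directly before visiting \<open>j\<close> the team is at \<open>c\<close>, and a home
  match in that slot would be its second match there. Position 0, where it is at home without a
  match, is excluded because slots are positive.\<close>

lemma travels_home_away:
  assumes s: "schedule n s" and "travels n (fixtures n s) t t j"
    and c: "(c, t) \<in> arcs n" "s (c, t) + 1 = s (j, t)"
  shows False
proof -
  obtain p where p: "at_venue n (fixtures n s) t p t" "s (j, t) = p + 1" "p < 2 * n - 1"
    using assms(2) unfolding travels_def at_venue_fixtures[OF s] by auto
  then have "s (c, t) = p"
    using c by simp
  moreover have "0 < s (c, t)"
    using schedule_slots[OF s c(1)] by (simp add: slots_def)
  ultimately obtain x where "(t, x) \<in> arcs n" "s (t, x) = s (c, t)"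
    using p by (auto simp: at_venue_fixtures[OF s] arcs_def)
  then show False
    using schedule_inj[OF s _ c(1), of "(t, x)" t] c by (auto simp: arcs_def)
qed

text \<open>The mirror image: the slot of \<open>(c, t)\<close> comes before the end of the season,
  so being home there would need a second match.\<close>

lemma travels_away_home:
  assumes s: "schedule n s" and "travels n (fixtures n s) t i t"
    and c: "(c, t) \<in> arcs n" "s (c, t) = s (i, t) + 1"
  shows False
proof -
  obtain p where p: "at_venue n (fixtures n s) t (p + 1) t" "s (i, t) = p"
    using assms(2) unfolding travels_def at_venue_fixtures[OF s] by auto
  then have "s (c, t) = p + 1"
    using c by simp
  moreover have "s (c, t) < 2 * n - 1"
    using schedule_slots[OF s c(1)] by (auto simp: slots_def)
  ultimately obtain x where "(t, x) \<in> arcs n" "s (t, x) = s (c, t)"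
    using p by (auto simp: at_venue_fixtures[OF s] arcs_def)
  then show False
    using schedule_inj[OF s _ c(1), of "(t, x)" t] c by (auto simp: arcs_def)
qed

text \<open>At least two teams other than \<open>t\<close> and \<open>j\<close> exist, and at most
  one of them hosts \<open>t\<close> in slot \<open>k\<close>.\<close>

lemma ex_away_avoiding:
  assumes s: "schedule n s" and n: "n \<ge> 4" and t: "t \<in> teams n"
  obtains c where "(c, t) \<in> arcs n" "c \<noteq> j" "s (c, t) \<noteq> k"
proof -
  have "card (teams n - {t, j}) \<ge> 2"
    using n diff_card_le_card_Diff[of "{t, j}" "teams n"] card_insert_le_m1[of 2 "{j}" t]
    by (auto simp: teams_def)
  then obtain c d where cd: "c \<in> teams n - {t, j}" "d \<in> teams n - {t, j}" "c \<noteq> d"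
    by (metis card_le_Suc0_iff_eq card.infinite not_less_eq_eq numeral_2_eq_2 zero_le)
  then have "s (c, t) \<noteq> s (d, t)"
    using schedule_inj[OF s, of "(c, t)" "(d, t)" t] t by (auto simp: mem_arcs)
  then show thesis
    using that[of c] that[of d] cd t by (cases "s (c, t) = k") (auto simp: mem_arcs)
qed

text \<open>If the slots agree, exchanging those of \<open>(j, t)\<close> and \<open>(t, j)\<close>
  moves \<open>(j, t)\<close> away and leaves \<open>b\<close> in place.\<close>

lemma ex_schedule_distinct_slots:
  assumes n: "even n" "n \<ge> 2" and q: "(j, t) \<in> arcs n" and b: "b \<in> arcs n" "b \<noteq> (j, t)"
  obtains s where "schedule n s" "s b \<noteq> s (j, t)"
proof -
  obtain s where s: "schedule n s"
    using ex_schedule[OF n] .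
  show thesis
  proof (cases "s b = s (j, t)")
    case True
    have "s (t, j) \<noteq> s (j, t)"
      using schedule_inj[OF s, of "(t, j)" "(j, t)" t] q by (auto simp: mem_arcs)
    then have "(s \<circ> Transposition.transpose (j, t) (t, j)) b \<noteq> (s \<circ> Transposition.transpose (j, t) (t, j)) (j, t)"
      using True b by (auto simp: Transposition.transpose_def)
    then show thesis
      using that schedule_reverse_pair[OF s q] by blast
  qed (use s that in blast)
qed

lemma ex_third_slot:
  assumes "n \<ge> 4"
  obtains w where "w \<in> slots n" "w \<noteq> u" "w \<noteq> v"
proof -
  have "(1::nat) \<in> slots n" "2 \<in> slots n" "3 \<in> slots n"
    using assms by (auto simp: slots_def)
  then show thesis
    using that[of 1] that[of 2] that[of 3] by fastforce
qed

text \<open>A travel between two away venues is avoided by not playing there consecutively in this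
  order; a travel from or to home by putting another away match directly before or after the
  visit.\<close>

lemma ex_schedule_no_travel:
  assumes n: "even n" "n \<ge> 4" and q: "(j, t) \<in> arcs n"
    and arc: "t' \<in> teams n" "(i, j') \<in> arcs n" and ne: "(t', i, j') \<noteq> (t, t, j)"
  obtains s where "schedule n s" "s (j, t) = 1" "\<not> travels n (fixtures n s) t' i j'"
proof -
  have n2: "n \<ge> 2"
    using n by simp
  have ij: "i \<noteq> j'" "i \<in> teams n" "j' \<in> teams n"
    using arc by (auto simp: mem_arcs)
  consider (aa) "i \<noteq> t'" "j' \<noteq> t'" | (ha) "i = t'" | (ah) "j' = t'"
    by blast
  then show thesis
  proof cases
    case aa
    obtain s where s: "schedule n s"
      using ex_schedule[OF n(1) n2] .
    have a: "(i, t') \<in> arcs n" and b: "(j', t') \<in> arcs n"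
      using aa ij arc by (auto simp: mem_arcs)
    have sl: "s (i, t') \<in> slots n" "s (j', t') \<in> slots n" "s (j, t) \<in> slots n"
      using schedule_slots[OF s] a b q by auto
    have dist: "s (i, t') \<noteq> s (j', t')"
      using schedule_inj[OF s a b, of t'] ij by auto
    obtain s' where s': "schedule n s'" "s' (j, t) = 1" "s' (j', t') \<noteq> s' (i, t') + 1"
    \<comment> \<open>If \<open>(j, t)\<close> shares its slot with one of the two visits, that slot
      becomes 1 and the other visit goes to slot 3, leaving a gap. Otherwise the visit to
      \<open>j'\<close> is put before the one to \<open>i\<close>.\<close>
    proof (cases "s (j, t) = s (i, t')")
      case True
      obtain w where "w \<in> slots n" "w \<noteq> s (i, t')" "w \<noteq> s (j', t')"
        using ex_third_slot[OF n(2)] .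
      then obtain s' where "schedule n s'" "\<And>a. s a = s (i, t') \<Longrightarrow> s' a = 1"
        "\<And>a. s a = s (j', t') \<Longrightarrow> s' a = 3"
        using schedule_first_three[OF s n(2) sl(1) _ sl(2), of w] dist by metis
      then show thesis
        using that[of s'] True by simp
    next
      case False
      show thesis
      proof (cases "s (j, t) = s (j', t')")
        case True
        obtain w where "w \<in> slots n" "w \<noteq> s (i, t')" "w \<noteq> s (j', t')"
          using ex_third_slot[OF n(2)] .
        then obtain s' where "schedule n s'" "\<And>a. s a = s (j', t') \<Longrightarrow> s' a = 1"
          "\<And>a. s a = s (i, t') \<Longrightarrow> s' a = 3"
          using schedule_first_three[OF s n(2) sl(2) _ sl(1), of w] dist by metis
        then show thesis
          using that[of s'] True by simp
      next
        assume "s (j, t) \<noteq> s (j', t')"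
        then obtain s' where "schedule n s'" "\<And>a. s a = s (j, t) \<Longrightarrow> s' a = 1"
          "\<And>a. s a = s (j', t') \<Longrightarrow> s' a = 2" "\<And>a. s a = s (i, t') \<Longrightarrow> s' a = 3"
          using schedule_first_three[OF s n(2) sl(3,2,1)] False dist by metis
        then show thesis
          using that[of s'] by simp
      qed
    qed
    then show thesis
      using that[of s'] travels_away_away[of n s' t' i j'] aa by blast
  next
    case ha
    \<comment> \<open>Here the excluded triple matters: \<open>(j, t)\<close> in slot 1 itself
      forces the travel of \<open>t\<close> from the start to \<open>j\<close>.\<close>
    have b: "(j', t') \<in> arcs n" and bne: "(j', t') \<noteq> (j, t)"
      using ha ij ne arc by (auto simp: mem_arcs)
    obtain s where s: "schedule n s" and sb: "s (j', t') \<noteq> s (j, t)"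
      using ex_schedule_distinct_slots[OF n(1) n2 q b bne] .
    obtain c where c: "(c, t') \<in> arcs n" "c \<noteq> j'" "s (c, t') \<noteq> s (j, t)"
      using ex_away_avoiding[OF s n(2) arc(1)] .
    have sc: "s (c, t') \<noteq> s (j', t')"
      using schedule_inj[OF s c(1) b, of t'] c by auto
    obtain s' where s': "schedule n s'" "\<And>a. s a = s (j, t) \<Longrightarrow> s' a = 1"
        "\<And>a. s a = s (c, t') \<Longrightarrow> s' a = 2" "\<And>a. s a = s (j', t') \<Longrightarrow> s' a = 3"
      using schedule_first_three[OF s n(2), of "s (j, t)" "s (c, t')" "s (j', t')"]
        schedule_slots[OF s] q b c sb sc by metis
    then have "\<not> travels n (fixtures n s') t' t' j'"
      using travels_home_away[OF s'(1) _ c(1)] by fastforce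
    then show thesis
      using that[of s'] s' ha by simp
  next
    case ah
    obtain s where s: "schedule n s"
      using ex_schedule[OF n(1) n2] .
    have a: "(i, t') \<in> arcs n"
      using ah arc by simp
    obtain c where c: "(c, t') \<in> arcs n" "c \<noteq> i" "s (c, t') \<noteq> s (j, t)"
      using ex_away_avoiding[OF s n(2) arc(1)] .
    have sc: "s (c, t') \<noteq> s (i, t')"
      using schedule_inj[OF s c(1) a, of t'] c by auto
    have sl: "s (i, t') \<in> slots n" "s (c, t') \<in> slots n" "s (j, t) \<in> slots n"
      using schedule_slots[OF s] a c q by auto
    obtain s' where s': "schedule n s'" "s' (j, t) = 1" "s' (c, t') = s' (i, t') + 1"
    proof (cases "s (i, t') = s (j, t)")
      case True
      obtain w where "w \<in> slots n" "w \<noteq> s (i, t')" "w \<noteq> s (c, t')"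
        using ex_third_slot[OF n(2)] .
      then obtain s' where "schedule n s'" "\<And>a. s a = s (i, t') \<Longrightarrow> s' a = 1"
        "\<And>a. s a = s (c, t') \<Longrightarrow> s' a = 2"
        using schedule_first_three[OF s n(2) sl(1,2), of w] sc by metis
      then show thesis
        using that[of s'] True by simp
    next
      case False
      then obtain s' where "schedule n s'" "\<And>a. s a = s (j, t) \<Longrightarrow> s' a = 1"
        "\<And>a. s a = s (i, t') \<Longrightarrow> s' a = 2" "\<And>a. s a = s (c, t') \<Longrightarrow> s' a = 3"
        using schedule_first_three[OF s n(2) sl(3,1,2)] c sc by metis
      then show thesis
        using that[of s'] by simp
    qed
    then show thesis
      using that[of s'] travels_away_home[OF s'(1) _ c(1)] ah by blast
  qed
qed

section \<open>Affine relations between incidence vectors\<close>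

lemma chi_disjoint_permutations:
  assumes disj: "\<And>k. \<sigma> k = k \<or> \<tau> k = k" and inj: "inj \<tau>"
  shows "(chi (fixtures CARD('n) s) :: real ^ ('n::card2) match_index) =
    chi (fixtures CARD('n) (\<sigma> \<circ> s)) + chi (fixtures CARD('n) (\<tau> \<circ> s))
      - chi (fixtures CARD('n) (\<sigma> \<circ> (\<tau> \<circ> s)))"
proof -
  have eq: "(of_bool (x = k) :: real) = of_bool (\<sigma> x = k) + of_bool (\<tau> x = k) - of_bool (\<sigma> (\<tau> x) = k)"
    for x k
  \<comment> \<open>If \<open>\<tau>\<close> fixes \<open>x\<close>, the first and last terms on the
    right cancel. Otherwise \<open>\<tau> x\<close> is moved too, so \<open>\<sigma>\<close> fixes
    both \<open>x\<close> and \<open>\<tau> x\<close>, and the last two terms cancel.\<close>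
  proof (cases "\<tau> x = x")
    case False
    then have "\<tau> (\<tau> x) \<noteq> \<tau> x"
      using inj by (simp add: inj_eq)
    then show ?thesis
      using disj[of x] disj[of "\<tau> x"] False by simp
  qed simp
  have ind: "indicator (fixtures CARD('n) f) (k, a) = (if a \<in> arcs CARD('n) then of_bool (f a = k) else 0 :: real)"
    for f k a
    by (simp add: indicator_def)
  have "indicator (fixtures CARD('n) s) m =
    (indicator (fixtures CARD('n) (\<sigma> \<circ> s)) m + indicator (fixtures CARD('n) (\<tau> \<circ> s)) m
      - indicator (fixtures CARD('n) (\<sigma> \<circ> (\<tau> \<circ> s))) m :: real)" for m
    using eq[of "s (snd m)" "fst m"]
    by (cases m, cases "snd m \<in> arcs CARD('n)") (simp_all only: ind o_apply fst_conv snd_conv, simp_all)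
  then show ?thesis
    by (simp add: chi_def vec_eq_iff)
qed

text \<open>The hypothesis \<open>base\<close> covers schedules that extend to a point of the face:
  the visit to \<open>j\<close> is in slot 1 or directly follows another away match.\<close>

lemma schedule_in_affine:
  fixes H :: "(real ^ ('n::card2) match_index) set"
  assumes H: "affine H" and n: "CARD('n) \<ge> 4" and q: "(j, t) \<in> arcs CARD('n)"
    and base: "\<And>s. schedule CARD('n) s \<Longrightarrow>
      s (j, t) = 1 \<or> (\<exists>c. (c, t) \<in> arcs CARD('n) \<and> s (c, t) + 1 = s (j, t)) \<Longrightarrow>
      chi (fixtures CARD('n) s) \<in> H"
    and s: "schedule CARD('n) s"
  shows "chi (fixtures CARD('n) s) \<in> H"
proof -
  let ?n = "CARD('n)"
  have t: "t \<in> teams ?n"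
    using q by (simp add: mem_arcs)
  have swap: "chi (fixtures ?n s) \<in> H"
    if "{a, b} \<inter> {c, d} = {}"
      "chi (fixtures ?n (Transposition.transpose a b \<circ> s)) \<in> H"
      "chi (fixtures ?n (Transposition.transpose c d \<circ> s)) \<in> H"
      "chi (fixtures ?n (Transposition.transpose a b \<circ> (Transposition.transpose c d \<circ> s))) \<in> H"
    for s a b c d
  proof -
    have "Transposition.transpose a b k = k \<or> Transposition.transpose c d k = k" for k
      using that(1) by (auto simp: Transposition.transpose_def)
    note eq = chi_disjoint_permutations[OF this Transposition.inj_transpose, where 'n = 'n and s = s]
    show ?thesis
      unfolding eq using mem_affine_3_minus[OF H that(2,3,4), of 1] by (simp add: add_diff_eq)
  qed
  have perm: "schedule ?n (Transposition.transpose a b \<circ> s)"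
    if "schedule ?n s" "a \<in> slots ?n" "b \<in> slots ?n" for s a b
    using that by (intro schedule_permute permutes_swap_id)
  \<comment> \<open>\<open>\<tau>\<close> moves the match to slot 1, and \<open>\<sigma>\<close> moves another away match directly before it. Their
    supports are disjoint unless the match is in slot 2, which is reduced to the other slots below.\<close>
  have late: "chi (fixtures ?n s) \<in> H" if s: "schedule ?n s" and p: "s (j, t) \<noteq> 2" for s
  proof -
    define p where "p = s (j, t)"
    obtain c where c: "(c, t) \<in> arcs ?n" "c \<noteq> j" "s (c, t) \<noteq> 1"
      using ex_away_avoiding[OF s n t] .
    have slots: "p \<in> slots ?n" "s (c, t) \<in> slots ?n"
      using schedule_slots[OF s] q c by (auto simp: p_def)
    have cp: "s (c, t) \<noteq> p"
      using schedule_inj[OF s c(1) q, of t] c by (auto simp: p_def)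
    show ?thesis
    proof (cases "p = 1 \<or> s (c, t) + 1 = p")
      case True
      then show ?thesis
        using base[OF s] c by (auto simp: p_def)
    next
      case False
      let ?\<sigma> = "Transposition.transpose (p - 1) (s (c, t))" and ?\<tau> = "Transposition.transpose 1 p"
      have p3: "p \<ge> 3"
        using slots False p by (auto simp: slots_def p_def)
      have in_slots: "p - 1 \<in> slots ?n" "1 \<in> slots ?n"
        using slots p3 by (auto simp: slots_def)
      show ?thesis
      proof (rule swap)
        show "{p - 1, s (c, t)} \<inter> {1, p} = {}"
          using p3 c cp by auto
        show "chi (fixtures ?n (?\<sigma> \<circ> s)) \<in> H"
        proof (rule base[OF perm[OF s in_slots(1) slots(2)]], intro disjI2 exI conjI)
          show "(?\<sigma> \<circ> s) (c, t) + 1 = (?\<sigma> \<circ> s) (j, t)"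
            using p3 cp by (auto simp: Transposition.transpose_def p_def)
        qed (rule c(1))
        show "chi (fixtures ?n (?\<tau> \<circ> s)) \<in> H"
          by (rule base[OF perm[OF s in_slots(2) slots(1)]]) (simp add: p_def)
        show "chi (fixtures ?n (?\<sigma> \<circ> (?\<tau> \<circ> s))) \<in> H"
        proof (rule base[OF perm[OF perm[OF s in_slots(2) slots(1)] in_slots(1) slots(2)]])
          \<comment> \<open>After \<open>?\<tau>\<close> the match is in slot 1, which
            \<open>?\<sigma>\<close> fixes because \<open>p - 1\<close> and \<open>s (c, t)\<close>
            both differ from 1.\<close>
          show "(?\<sigma> \<circ> (?\<tau> \<circ> s)) (j, t) = 1 \<or>
              (\<exists>c'. (c', t) \<in> arcs ?n \<and> (?\<sigma> \<circ> (?\<tau> \<circ> s)) (c', t) + 1 = (?\<sigma> \<circ> (?\<tau> \<circ> s)) (j, t))"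
            using p3 c by (auto simp: Transposition.transpose_def p_def)
        qed
      qed
    qed
  qed
  show ?thesis
  proof (cases "s (j, t) = 2")
    case p: True
    obtain c where c: "(c, t) \<in> arcs ?n" "c \<noteq> j" "s (c, t) \<noteq> 1"
      using ex_away_avoiding[OF s n t] .
    have cp: "s (c, t) \<noteq> 2"
      using schedule_inj[OF s c(1) q, of t] c p by auto
    \<comment> \<open>\<open>?\<tau>\<close> moves the match from slot 2 to \<open>k\<close>, where
      \<open>late\<close> applies; \<open>?\<sigma>\<close> moves the match at \<open>c\<close> to
      slot 1, directly before slot 2. The choice of \<open>k\<close> keeps the supports
      disjoint.\<close>
    define k where "k = (if s (c, t) = 3 then 4 else 3 :: nat)"
    have slots: "1 \<in> slots ?n" "s (c, t) \<in> slots ?n" "2 \<in> slots ?n" "k \<in> slots ?n"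
      using schedule_slots[OF s c(1)] n by (auto simp: slots_def k_def)
    have k: "k \<noteq> s (c, t)" "k \<ge> 3"
      by (auto simp: k_def)
    let ?\<sigma> = "Transposition.transpose 1 (s (c, t))" and ?\<tau> = "Transposition.transpose 2 k"
    show ?thesis
    proof (rule swap)
      show "{1, s (c, t)} \<inter> {2, k} = {}"
        using k c cp by auto
      show "chi (fixtures ?n (?\<sigma> \<circ> s)) \<in> H"
      proof (rule base[OF perm[OF s slots(1,2)]], intro disjI2 exI conjI)
        show "(?\<sigma> \<circ> s) (c, t) + 1 = (?\<sigma> \<circ> s) (j, t)"
          using p cp by (auto simp: Transposition.transpose_def)
      qed (rule c(1))
      show "chi (fixtures ?n (?\<tau> \<circ> s)) \<in> H"
        using p k by (intro late perm[OF s slots(3,4)]) simp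
      show "chi (fixtures ?n (?\<sigma> \<circ> (?\<tau> \<circ> s))) \<in> H"
        using p k by (intro late perm[OF perm[OF s slots(3,4)] slots(1,2)])
          (auto simp: Transposition.transpose_def)
    qed
  qed (rule late[OF s])
qed

section \<open>Points of the polytope and vertical directions\<close>

lemma match_triple_inverse_arcs:
  assumes "k \<in> slots CARD('n)" and "a \<in> arcs CARD('n)"
  shows "match_triple (match_index (k, a) :: ('n::card2) match_index) = (k, a)"
  using assms by (intro match_index_inverse) (simp add: matches_def)

lemma travel_triple_inverse_arcs:
  assumes "t \<in> teams CARD('n)" and "a \<in> arcs CARD('n)"
  shows "travel_triple (travel_index (t, a) :: ('n::card2) travel_index) = (t, a)"
  using assms by (intro travel_index_inverse) simp

lemma chi_fixtures_nth:
  assumes "k \<in> slots CARD('n)" and "a \<in> arcs CARD('n)"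
  shows "(chi (fixtures CARD('n) s) :: real ^ ('n::card2) match_index) $ match_index (k, a) =
    of_bool (s a = k)"
  using assms by (simp add: chi_def match_triple_inverse_arcs indicator_def)

text \<open>The all-ones vector dominates every travel vector, so it serves as a common height above
  all tournaments.\<close>

lemma one_in_p_utt:
  assumes "schedule CARD('n) s"
  shows "(chi (fixtures CARD('n) s), 1) \<in> (p_utt :: ('n::card2) utt_space set)"
  unfolding p_utt_def
  by (rule hull_inc) (use tournament_fixtures[OF assms] in \<open>auto simp: psi_def split: prod.splits\<close>)

lemma one_minus_axis_in_p_utt:
  assumes "schedule CARD('n) s" and "t \<in> teams CARD('n)" "(i, j) \<in> arcs CARD('n)"
    and "\<not> travels CARD('n) (fixtures CARD('n) s) t i j"
  shows "(chi (fixtures CARD('n) s), 1 - axis (travel_index (t, i, j)) 1)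
    \<in> (p_utt :: ('n::card2) utt_space set)"
  unfolding p_utt_def
  by (rule hull_inc) (use tournament_fixtures[OF assms(1)] assms(2-4) in
    \<open>auto simp: psi_def axis_def travel_triple_inverse_arcs split: prod.splits\<close>)

text \<open>Each pair from \<open>dirs\<close> differs by a vertical unit vector, which is therefore
  a direction of \<open>H\<close>; together these span all vertical directions.\<close>

lemma affine_vertical_translate:
  fixes H :: "('a::real_vector \<times> (real ^ 'k)) set"
  assumes H: "affine H"
    and dirs: "\<And>\<alpha>. \<exists>x. (x, 1) \<in> H \<and> (x, 1 - axis \<alpha> 1) \<in> H"
    and xy: "(x, y) \<in> H"
  shows "(x, y') \<in> H"
proof -
  define D where "D = {v. \<forall>z\<in>H. z + (0, v) \<in> H}"
  have "c *\<^sub>R axis \<alpha> 1 \<in> D" for c \<alpha>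
  proof -
    obtain x where "(x, 1) \<in> H" "(x, 1 - axis \<alpha> 1) \<in> H"
      using dirs by blast
    then show ?thesis
      unfolding D_def using mem_affine_3_minus[OF H, of _ "(x, 1)" "(x, 1 - axis \<alpha> 1)" c]
      by auto
  qed
  moreover have "0 \<in> D" and "v + w \<in> D" if "v \<in> D" "w \<in> D" for v w
  proof -
    have "z + (0, v + w) = (z + (0, v)) + (0, w)" for z :: "'a \<times> (real ^ 'k)"
      by (cases z) (simp add: add.assoc)
    with that show "v + w \<in> D"
      unfolding D_def mem_Collect_eq by metis
  qed (simp add: D_def flip: zero_prod_def)
  ultimately have "(\<Sum>\<alpha>\<in>A. (v $ \<alpha>) *\<^sub>R axis \<alpha> 1) \<in> D" for v and A :: "'k set"
    by (induction A rule: infinite_finite_induct) auto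
  from this[of "y' - y" UNIV] have "y' - y \<in> D"
    using basis_expansion[of "y' - y"] by (simp add: scalar_mult_eq_scaleR)
  then have "(x, y) + (0, y' - y) \<in> H"
    using xy unfolding D_def by blast
  then show ?thesis
    by simp
qed

section \<open>Validity and the facet property\<close>

lemma match_le_travel_on_p_utt:
  fixes t j :: nat
  assumes q: "(j, t) \<in> arcs CARD('n::card2)" and z: "(x, y) \<in> (p_utt :: 'n utt_space set)"
  shows "x $ match_index (1, j, t) \<le> y $ travel_index (t, t, j)"
proof -
  let ?m = "match_index (1, j, t) :: 'n match_index" and ?\<alpha> = "travel_index (t, t, j) :: 'n travel_index"
  let ?a = "(- axis ?m 1, axis ?\<alpha> 1) :: 'n utt_space"
  have tj: "t \<in> teams CARD('n)" "(t, j) \<in> arcs CARD('n)"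
    using q by (auto simp: mem_arcs)
  have one: "1 \<in> slots CARD('n)"
    using one_less_card[where 'a = 'n] by (simp add: slots_def)
  have "x $ ?m \<le> y $ ?\<alpha>"
    if T: "tournament CARD('n) T" and x: "x = chi T" and y: "\<forall>a. psi T $ a \<le> y $ a" "\<forall>a. y $ a \<in> {0, 1}"
    for T x y
  proof (cases "(1, j, t) \<in> T")
    case True
    \<comment> \<open>Position 0 is the witness: \<open>t\<close> starts at home and is at
      \<open>j\<close> in slot 1.\<close>
    then have "travels CARD('n) T t t j"
      using one_less_card[where 'a = 'n] one q
      unfolding travels_def at_venue_def mem_arcs by (intro conjI exI[of _ 0]) auto
    then have "psi T $ ?\<alpha> = 1"
      by (simp add: psi_def travel_triple_inverse_arcs tj)
    then show ?thesis
      using y(1)[rule_format, of ?\<alpha>] by (simp add: x chi_def indicator_def)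
  next
    case False
    then show ?thesis
      using y(2)[rule_format, of ?\<alpha>] match_triple_inverse_arcs[OF one q] by (auto simp: x chi_def)
  qed
  then have "(p_utt :: 'n utt_space set) \<subseteq> {z. 0 \<le> ?a \<bullet> z}"
    unfolding p_utt_def
    by (intro hull_minimal convex_halfspace_ge)
      (auto simp: inner_axis' inner_axis)
  then show ?thesis
    using z by (auto simp: inner_axis inner_axis')
qed

theorem theorem12:
  fixes t j :: nat
  assumes "even CARD('n::card2)" and "CARD('n) \<ge> 4" and "(t, j) \<in> arcs CARD('n)"
  shows "facet_defining (p_utt :: 'n utt_space set)
           (\<lambda>(x, y). x $ match_index (1, j, t)) (\<lambda>(x, y). y $ travel_index (t, t, j))"
proof -
  let ?n = "CARD('n)"
  let ?P = "p_utt :: 'n utt_space set"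
  let ?m = "match_index (1, j, t) :: 'n match_index" and ?\<alpha> = "travel_index (t, t, j) :: 'n travel_index"
  let ?a = "(- axis ?m 1, axis ?\<alpha> 1) :: 'n utt_space"
  define F where "F = {z \<in> ?P. (case z of (x, y) \<Rightarrow> x $ ?m) = (case z of (x, y) \<Rightarrow> y $ ?\<alpha>)}"
  have q: "(j, t) \<in> arcs ?n" and t: "t \<in> teams ?n"
    using assms(3) by (auto simp: mem_arcs)
  have one: "1 \<in> slots ?n" "2 \<in> slots ?n"
    using assms(2) by (auto simp: slots_def)
  have F: "(x, y) \<in> F \<longleftrightarrow> (x, y) \<in> ?P \<and> x $ ?m = y $ ?\<alpha>" for x y
    by (simp add: F_def)
  note chi_m = chi_fixtures_nth[OF one(1) q, unfolded One_nat_def]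
  have face: "F face_of ?P"
  proof -
    have "F = ?P \<inter> {z. ?a \<bullet> z = 0}"
      by (auto simp: F_def inner_axis inner_axis')
    moreover have "?a \<bullet> z \<ge> 0" if "z \<in> ?P" for z
      using match_le_travel_on_p_utt[OF q, of "fst z" "snd z"] that
      by (cases z) (simp add: inner_axis inner_axis')
    ultimately show ?thesis
      using face_of_Int_supporting_hyperplane_ge[of ?P 0 ?a] by (simp add: p_utt_def)
  qed
  obtain s where s: "schedule ?n s"
    using ex_schedule[of ?n] assms by auto
  obtain c where c: "(c, t) \<in> arcs ?n" "c \<noteq> j" "s (c, t) \<noteq> 0"
    using ex_away_avoiding[OF s assms(2) t] .
  have sc: "s (c, t) \<noteq> s (j, t)"
    using schedule_inj[OF s c(1) q, of t] c by auto
  obtain w where w: "w \<in> slots ?n" "w \<noteq> s (c, t)" "w \<noteq> s (j, t)"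
    using ex_third_slot[OF assms(2)] .
  obtain s0 where s0: "schedule ?n s0" "s0 (c, t) = 1" "s0 (j, t) = 2"
    using schedule_first_three[OF s assms(2), of "s (c, t)" "s (j, t)" w]
      schedule_slots[OF s] c q w sc by metis
  \<comment> \<open>In \<open>s0\<close> team \<open>t\<close> goes from \<open>c\<close> straight
    to \<open>j\<close>, so at height 1 the coordinates are 0 and 1, off the face; lowering
    \<open>?\<alpha>\<close> gives the point \<open>s0F\<close> on the face. The pair supplies the
    direction \<open>?\<alpha>\<close>.\<close>
  define p :: "'n utt_space" where "p = (chi (fixtures ?n s0), 1)"
  define H where "H = affine hull (insert p F)"
  have H: "affine H" and FH: "insert p F \<subseteq> H"
    using hull_subset[of "insert p F" affine] by (auto simp: H_def)
  have first: "(chi (fixtures ?n s), 1) \<in> F" if "schedule ?n s" "s (j, t) = 1" for s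
    using that one_in_p_utt[OF that(1)] by (simp add: F chi_m)
  have after_away: "(chi (fixtures ?n s), 1 - axis ?\<alpha> 1) \<in> F"
    if s: "schedule ?n s" and c: "(c, t) \<in> arcs ?n" "s (c, t) + 1 = s (j, t)" for s c
  proof -
    \<comment> \<open>Hence \<open>(j, t)\<close> is played after slot 1 and both sides of the
      inequality are 0.\<close>
    have "s (c, t) \<ge> 1"
      using schedule_slots[OF s c(1)] by (simp add: slots_def)
    moreover have "\<not> travels ?n (fixtures ?n s) t t j"
      using travels_home_away[OF s _ c] by blast
    ultimately show ?thesis
      using one_minus_axis_in_p_utt[OF s t assms(3)] c by (simp add: F chi_m)
  qed
  have s0F: "(chi (fixtures ?n s0), 1 - axis ?\<alpha> 1) \<in> F"
    using s0 c by (intro after_away[of s0 c]) auto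
  have pP: "p \<in> ?P" and pF: "p \<notin> F"
    using one_in_p_utt[OF s0(1)] s0 by (auto simp: p_def F chi_m)
  have dirs: "\<exists>x. (x, 1) \<in> H \<and> (x, 1 - axis \<beta> 1) \<in> H" for \<beta>
  proof (cases "\<beta> = ?\<alpha>")
    case True
    then show ?thesis
      using s0F FH by (auto simp: p_def)
  next
    case False
    obtain t' i j' where \<beta>: "travel_triple \<beta> = (t', i, j')"
      by (metis prod_cases3)
    then have arc: "t' \<in> teams ?n" "(i, j') \<in> arcs ?n" and \<beta>': "\<beta> = travel_index (t', i, j')"
      using travel_triple[of \<beta>] travel_triple_inverse[of \<beta>] by auto
    obtain s where s: "schedule ?n s" "s (j, t) = 1" "\<not> travels ?n (fixtures ?n s) t' i j'"
      using ex_schedule_no_travel[OF assms(1,2) q arc] False \<beta>' by auto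
    have "(chi (fixtures ?n s), 1 - axis \<beta> 1) \<in> F"
      using one_minus_axis_in_p_utt[OF s(1) arc s(3)] False s
      by (simp add: F chi_m \<beta>'[symmetric] axis_def)
    then show ?thesis
      using first[OF s(1,2)] FH by blast
  qed
  \<comment> \<open>With all vertical directions in \<open>H\<close>, only the first component
    matters, so the slice at height 1 is used.\<close>
  have "chi (fixtures ?n s) \<in> {x. (x, 1) \<in> H}" if s: "schedule ?n s" for s
  proof (rule schedule_in_affine[OF _ assms(2) q _ s])
    show "affine {x. (x, 1) \<in> H}"
      unfolding affine_def
    proof (intro ballI allI impI CollectI)
      fix x y and u v :: real
      assume xy: "x \<in> {x. (x, 1) \<in> H}" "y \<in> {x. (x, 1) \<in> H}" and uv: "u + v = 1"
      have "u *\<^sub>R (x, 1) + v *\<^sub>R (y, 1) \<in> H"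
        using xy uv by (intro mem_affine[OF H]) auto
      then show "(u *\<^sub>R x + v *\<^sub>R y, 1) \<in> H"
        by (simp add: scaleR_add_left[symmetric] uv)
    qed
  next
    fix s
    assume s: "schedule ?n s"
      and "s (j, t) = 1 \<or> (\<exists>c. (c, t) \<in> arcs ?n \<and> s (c, t) + 1 = s (j, t))"
    then obtain y where "(chi (fixtures ?n s), y) \<in> H"
      using first[OF s] after_away[OF s] FH by blast
    then show "chi (fixtures ?n s) \<in> {x. (x, 1) \<in> H}"
      using affine_vertical_translate[OF H dirs] by blast
  qed
  then have "(chi (fixtures ?n s), y) \<in> H" if "schedule ?n s" for s y
    using affine_vertical_translate[OF H dirs] that by blast
  then have "?P \<subseteq> H"
    unfolding p_utt_def
    by (intro hull_minimal affine_imp_convex[OF H]) (auto elim!: tournament_imp_schedule)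
  \<comment> \<open>One extra point raises the dimension by at most 1, while a proper face has
    smaller dimension, so the codimension is exactly 1.\<close>
  then have "aff_dim ?P \<le> aff_dim (insert p F)"
    using aff_dim_subset[of ?P H] by (simp add: H_def)
  also have "\<dots> \<le> aff_dim F + 1"
    by (simp add: aff_dim_insert)
  finally have "aff_dim ?P \<le> aff_dim F + 1" .
  moreover have "aff_dim F < aff_dim ?P"
    using face pP pF by (intro face_of_aff_dim_lt) (auto simp: p_utt_def)
  ultimately have "F facet_of ?P"
    using face s0F by (auto simp: facet_of_def)
  then show ?thesis
    using match_le_travel_on_p_utt[OF q] unfolding facet_defining_def F_def by auto
qed

end
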